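(* Let $A$, the iterates $u_k$, the matrices $J_k$ and the errors $e_k$ be as in the context. There exist a positive number $\delta$ and a constant $c_1$ such that if $\|e_k\|<\delta$ then $$\|J_{k+1}-J_k\|\le c_1\|e_k\|.$$
   Context: $A\in\mathbb{R}^{n\times n}$ is symmetric positive definite with eigenvalues $\lambda_1<\lambda_2<\dots<\lambda_n$ and unit eigenvector $v_1$ for $\lambda_1$. Vector norms are Euclidean and the norm of a symmetric matrix is the spectral norm. Newton iteration: $u_0$ is a unit vector; for $k\ge 0$, $\theta_k=u_k^\top A u_k$, $$J_k=(I-u_ku_k^\top)(A-\theta_k I)(I-u_ku_k^\top),$$ $s_k$ is an (exact or approximate) solution, lying in the subspace orthogonal to $u_k$, of the correction equation $J_ks_k=-(Au_k-\theta_ku_k)$, and $u_{k+1}=(u_k+s_k)/\|u_k+s_k\|$. Set $e_k=u_k-v_1$. Standing assumption: convergence holds, i.e. there is a constant $r<1$ with $\|e_{k+1}\|<r\|e_k\|$ for all $k\ge0$. The numbers $\delta$ and $c_1$ do not depend on $k$. *)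

theory Defs
  imports "HOL-Analysis.Analysis"
begin

definition symmetric_matrix :: "real^'n^'n \<Rightarrow> bool" where
  "symmetric_matrix A \<longleftrightarrow> transpose A = A"

definition positive_definite :: "real^'n^'n \<Rightarrow> bool" where
  "positive_definite A \<longleftrightarrow> (\<forall>x. x \<noteq> 0 \<longrightarrow> x \<bullet> (A *v x) > 0)"

definition eigenvector :: "real^'n^'n \<Rightarrow> real \<Rightarrow> real^'n \<Rightarrow> bool" where
  "eigenvector A \<mu> v \<longleftrightarrow> v \<noteq> 0 \<and> A *v v = \<mu> *\<^sub>R v"

definition eigenvalue :: "real^'n^'n \<Rightarrow> real \<Rightarrow> bool" where
  "eigenvalue A \<mu> \<longleftrightarrow> (\<exists>v. eigenvector A \<mu> v)"

(* The library's norm on real^'n^'n is the Frobenius norm. The spectral norm is the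
   operator norm induced by the Euclidean norm. *)
definition spectral_norm :: "real^'n^'n \<Rightarrow> real" where
  "spectral_norm M = onorm (\<lambda>x. M *v x)"

definition rayleigh :: "real^'n^'n \<Rightarrow> real^'n \<Rightarrow> real" where
  "rayleigh A u = u \<bullet> (A *v u)"

(* u u^T as a column times a row; the inner dimension is the one-element type 1. *)
definition outer_square :: "real^'n \<Rightarrow> real^'n^'n" where
  "outer_square u = (columnvector u :: real^1^'n) ** (rowvector u :: real^'n^1)"

definition correction_matrix :: "real^'n^'n \<Rightarrow> real^'n \<Rightarrow> real^'n^'n" where
  "correction_matrix A u =
     (mat 1 - outer_square u) ** (A - rayleigh A u *\<^sub>R mat 1) ** (mat 1 - outer_square u)"

(* s solves J s = -(A u - theta u) in the orthogonal complement of u, with residual of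
   norm at most eps. The solution is exact for eps = 0. *)
definition correction_solution :: "real^'n^'n \<Rightarrow> real^'n \<Rightarrow> real \<Rightarrow> real^'n \<Rightarrow> bool" where
  "correction_solution A u \<epsilon> s \<longleftrightarrow>
     s \<bullet> u = 0 \<and>
     norm (correction_matrix A u *v s - (- (A *v u - rayleigh A u *\<^sub>R u))) \<le> \<epsilon>"

(* The tolerances eps k are arbitrary: no accuracy is prescribed for the approximate
   solutions. u k + s k is nonzero, because s k is orthogonal to the unit vector u k. *)
definition newton_iteration ::
  "real^'n^'n \<Rightarrow> (nat \<Rightarrow> real) \<Rightarrow> (nat \<Rightarrow> real^'n) \<Rightarrow> (nat \<Rightarrow> real^'n) \<Rightarrow> bool" where
  "newton_iteration A \<epsilon> s u \<longleftrightarrow>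
     norm (u 0) = 1 \<and>
     (\<forall>k. correction_solution A (u k) (\<epsilon> k) (s k) \<and>
          u (Suc k) = (u k + s k) /\<^sub>R norm (u k + s k))"

end

(* On unit vectors the map w |-> correction_matrix A w is Lipschitz, by telescoping the triple
   product and bounding each factor. Since the errors decrease,
   |u_{k+1} - u_k| <= |e_{k+1}| + |e_k| <= 2 |e_k|. *)
theory Submission
  imports Defs
begin

lemma matrix_diff_ldistrib: "A ** (B - C) = A ** B - A ** (C :: real^'n^'m)"
  by (vector matrix_matrix_mult_def sum_subtractf[symmetric] right_diff_distrib)

lemma matrix_diff_rdistrib: "(A - B) ** C = A ** C - B ** (C :: real^'n^'m)"
  by (vector matrix_matrix_mult_def sum_subtractf[symmetric] left_diff_distrib)

lemma norm_le_spectral_norm: "norm (M *v x) \<le> spectral_norm M * norm x"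
  unfolding spectral_norm_def
  by (rule onorm[OF matrix_vector_mul_bounded_linear])

lemma spectral_norm_le:
  assumes "\<And>x. norm (M *v x) \<le> b * norm x"
  shows "spectral_norm M \<le> b"
  unfolding spectral_norm_def by (rule onorm_le) (use assms in auto)

lemma spectral_norm_nonneg: "0 \<le> spectral_norm M"
  unfolding spectral_norm_def
  by (rule onorm_pos_le[OF matrix_vector_mul_bounded_linear])

lemma spectral_norm_add: "spectral_norm (M + N) \<le> spectral_norm M + spectral_norm N"
  unfolding spectral_norm_def matrix_vector_mult_add_rdistrib
  by (rule onorm_triangle) (rule matrix_vector_mul_bounded_linear)+

lemma spectral_norm_minus: "spectral_norm (- M) = spectral_norm M"
proof -
  have "(\<lambda>x. (- M) *v x) = (\<lambda>x. - (M *v x))"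
    by (simp add: fun_eq_iff vec_eq_iff matrix_vector_mult_def sum_negf)
  then show ?thesis
    by (simp add: spectral_norm_def onorm_neg)
qed

lemma spectral_norm_diff: "spectral_norm (M - N) \<le> spectral_norm M + spectral_norm N"
  using spectral_norm_add[of M "- N"] by (simp add: spectral_norm_minus)

lemma spectral_norm_mult:
  fixes M :: "real^'n^'n" and N :: "real^'n^'n"
  shows "spectral_norm (M ** N) \<le> spectral_norm M * spectral_norm N"
proof (rule spectral_norm_le)
  fix x
  have "norm ((M ** N) *v x) = norm (M *v (N *v x))"
    by (simp add: matrix_vector_mul_assoc)
  also have "\<dots> \<le> spectral_norm M * norm (N *v x)"
    by (rule norm_le_spectral_norm)
  also have "\<dots> \<le> spectral_norm M * (spectral_norm N * norm x)"
    by (intro mult_left_mono norm_le_spectral_norm spectral_norm_nonneg)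
  finally show "norm ((M ** N) *v x) \<le> spectral_norm M * spectral_norm N * norm x"
    by (simp add: mult.assoc)
qed

lemma spectral_norm_mult_le:
  fixes M N :: "real^'n^'n"
  assumes "spectral_norm M \<le> a" "spectral_norm N \<le> b"
  shows "spectral_norm (M ** N) \<le> a * b"
  using spectral_norm_mult[of M N] assms
    mult_mono'[OF assms spectral_norm_nonneg spectral_norm_nonneg] by linarith

lemma spectral_norm_scaleR_mat_1_le: "spectral_norm (c *\<^sub>R mat 1 :: real^'n^'n) \<le> \<bar>c\<bar>"
  by (rule spectral_norm_le) (simp add: scaleR_matrix_vector_assoc[symmetric])

lemma outer_square_mult_vec: "outer_square u *v x = (u \<bullet> x) *\<^sub>R u"
  by (simp add: vec_eq_iff outer_square_def matrix_vector_mult_def matrix_matrix_mult_def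
      columnvector_def rowvector_def inner_vec_def sum_distrib_left mult_ac)

lemma outer_square_diff_le:
  assumes "norm u = 1" "norm w = 1"
  shows "spectral_norm (outer_square u - outer_square w) \<le> 2 * norm (u - w)"
proof (rule spectral_norm_le)
  fix x
  have "(outer_square u - outer_square w) *v x = (u \<bullet> x) *\<^sub>R (u - w) + ((u - w) \<bullet> x) *\<^sub>R w"
    by (simp add: matrix_vector_mult_diff_rdistrib outer_square_mult_vec algebra_simps)
  also have "norm \<dots> \<le> \<bar>u \<bullet> x\<bar> * norm (u - w) + \<bar>(u - w) \<bullet> x\<bar>"
    using norm_triangle_ineq[of "(u \<bullet> x) *\<^sub>R (u - w)" "((u - w) \<bullet> x) *\<^sub>R w"] assms by simp
  also have "\<dots> \<le> norm x * norm (u - w) + norm (u - w) * norm x"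
    using Cauchy_Schwarz_ineq2[of u x] Cauchy_Schwarz_ineq2[of "u - w" x] assms
    by (intro add_mono mult_right_mono) auto
  finally show "norm ((outer_square u - outer_square w) *v x) \<le> 2 * norm (u - w) * norm x"
    by (simp add: mult_ac)
qed

lemma spectral_norm_projection_le:
  assumes "norm u = 1"
  shows "spectral_norm (mat 1 - outer_square u) \<le> 2"
proof (rule spectral_norm_le)
  fix x
  have "norm ((mat 1 - outer_square u) *v x) \<le> norm x + \<bar>u \<bullet> x\<bar>"
    using norm_triangle_ineq4[of x "(u \<bullet> x) *\<^sub>R u"] assms
    by (simp add: matrix_vector_mult_diff_rdistrib outer_square_mult_vec)
  also have "\<dots> \<le> 2 * norm x"
    using Cauchy_Schwarz_ineq2[of u x] assms by simp
  finally show "norm ((mat 1 - outer_square u) *v x) \<le> 2 * norm x" .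
qed

lemma inner_mult_vec_le: "\<bar>x \<bullet> (A *v y)\<bar> \<le> spectral_norm A * norm x * norm y"
  using Cauchy_Schwarz_ineq2[of x "A *v y"]
    mult_left_mono[OF norm_le_spectral_norm[of A y] norm_ge_zero[of x]]
  by (simp add: mult_ac)

lemma rayleigh_diff_le:
  assumes "norm u = 1" "norm w = 1"
  shows "\<bar>rayleigh A u - rayleigh A w\<bar> \<le> 2 * spectral_norm A * norm (u - w)"
proof -
  have "rayleigh A u - rayleigh A w = u \<bullet> (A *v (u - w)) + (u - w) \<bullet> (A *v w)"
    by (simp add: rayleigh_def matrix_vector_mult_diff_distrib inner_diff_left inner_diff_right)
  then show ?thesis
    using inner_mult_vec_le[of u A "u - w"] inner_mult_vec_le[of "u - w" A w] assms by simp
qed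

lemma spectral_norm_shift_le:
  assumes "norm u = 1"
  shows "spectral_norm (A - rayleigh A u *\<^sub>R mat 1) \<le> 2 * spectral_norm A"
  using spectral_norm_diff[of A "rayleigh A u *\<^sub>R mat 1"]
    spectral_norm_scaleR_mat_1_le[of "rayleigh A u", where 'n='a]
    inner_mult_vec_le[of u A u] assms
  by (simp add: rayleigh_def)

lemma correction_matrix_lipschitz:
  fixes A :: "real^'n^'n"
  assumes "norm u = 1" "norm w = 1"
  shows "spectral_norm (correction_matrix A u - correction_matrix A w)
    \<le> 24 * spectral_norm A * norm (u - w)"
proof -
  define P where "P = mat 1 - outer_square u"
  define Q where "Q = mat 1 - outer_square w"
  define M where "M = A - rayleigh A u *\<^sub>R mat 1"
  define N where "N = A - rayleigh A w *\<^sub>R mat 1"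
  define a where "a = spectral_norm A"
  define d where "d = norm (u - w)"
  have P: "spectral_norm P \<le> 2" and Q: "spectral_norm Q \<le> 2"
    and M: "spectral_norm M \<le> 2 * a" and N: "spectral_norm N \<le> 2 * a"
    unfolding P_def Q_def M_def N_def a_def
    using assms by (simp_all add: spectral_norm_projection_le spectral_norm_shift_le)
  have "P - Q = outer_square w - outer_square u"
    by (simp add: P_def Q_def)
  then have PQ: "spectral_norm (P - Q) \<le> 2 * d"
    using outer_square_diff_le[of w u] assms by (simp add: d_def norm_minus_commute)
  have "M - N = (rayleigh A w - rayleigh A u) *\<^sub>R mat 1"
    by (simp add: M_def N_def algebra_simps)
  then have MN: "spectral_norm (M - N) \<le> 2 * a * d"
    using spectral_norm_scaleR_mat_1_le[of "rayleigh A w - rayleigh A u", where 'n='n]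
      rayleigh_diff_le[of w u A] assms
    by (simp add: a_def d_def norm_minus_commute)
  have "P ** M ** P - Q ** N ** Q
      = (P - Q) ** M ** P + Q ** (M - N) ** P + Q ** N ** (P - Q)"
    by (simp add: matrix_diff_ldistrib matrix_diff_rdistrib matrix_mul_assoc)
  then have "spectral_norm (P ** M ** P - Q ** N ** Q)
      \<le> spectral_norm ((P - Q) ** M ** P) + spectral_norm (Q ** (M - N) ** P)
        + spectral_norm (Q ** N ** (P - Q))"
    by (metis (no_types) add_right_mono order_trans spectral_norm_add)
  also have "\<dots> \<le> (2 * d) * (2 * a) * 2 + 2 * (2 * a * d) * 2 + 2 * (2 * a) * (2 * d)"
    by (intro add_mono spectral_norm_mult_le P Q M N PQ MN)
  finally show ?thesis
    by (simp add: correction_matrix_def P_def Q_def M_def N_def a_def d_def mult_ac)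
qed

lemma newton_iteration_norm:
  assumes "newton_iteration A \<epsilon> s u"
  shows "norm (u k) = 1"
proof (induction k)
  case 0
  then show ?case using assms by (simp add: newton_iteration_def)
next
  case (Suc k)
  have orth: "s k \<bullet> u k = 0" and step: "u (Suc k) = (u k + s k) /\<^sub>R norm (u k + s k)"
    using assms by (auto simp: newton_iteration_def correction_solution_def)
  have "(u k + s k) \<bullet> u k = 1"
    using orth Suc by (simp add: inner_add_left dot_square_norm)
  then have "u k + s k \<noteq> 0" by auto
  then show ?case by (simp add: step)
qed

theorem lemma3p5:
  fixes A :: "real^'n^'n"
    and lam :: "nat \<Rightarrow> real"
    and v1 :: "real^'n"
    and \<epsilon> :: "nat \<Rightarrow> real"
    and s u e :: "nat \<Rightarrow> real^'n"
    and J :: "nat \<Rightarrow> real^'n^'n"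
    and r :: real
  assumes "symmetric_matrix A"
    and "positive_definite A"
    and "strict_mono_on {1..CARD('n)} lam"
    and "{\<mu>. eigenvalue A \<mu>} = lam ` {1..CARD('n)}"
    and "eigenvector A (lam 1) v1"
    and "norm v1 = 1"
    and "newton_iteration A \<epsilon> s u"
    and "\<And>k. J k = correction_matrix A (u k)"
    and "\<And>k. e k = u k - v1"
    and "r < 1"
    and "\<And>k. norm (e (Suc k)) < r * norm (e k)"
  shows "\<exists>\<delta> c1. \<delta> > 0 \<and>
           (\<forall>k. norm (e k) < \<delta> \<longrightarrow> spectral_norm (J (Suc k) - J k) \<le> c1 * norm (e k))"
proof -
  have unit: "norm (u k) = 1" for k
    using newton_iteration_norm[OF assms(7)] .
  have "spectral_norm (J (Suc k) - J k) \<le> 48 * spectral_norm A * norm (e k)" for k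
  proof -
    have "norm (e (Suc k)) \<le> norm (e k)"
      using assms(11)[of k] mult_right_mono[of r 1 "norm (e k)"] \<open>r < 1\<close> by simp
    moreover have "u (Suc k) - u k = e (Suc k) - e k"
      by (simp add: assms(9))
    ultimately have step: "norm (u (Suc k) - u k) \<le> 2 * norm (e k)"
      using norm_triangle_ineq4[of "e (Suc k)" "e k"] by simp
    have "spectral_norm (J (Suc k) - J k) \<le> 24 * spectral_norm A * norm (u (Suc k) - u k)"
      unfolding assms(8) by (rule correction_matrix_lipschitz[OF unit unit])
    also have "\<dots> \<le> 24 * spectral_norm A * (2 * norm (e k))"
      using step by (intro mult_left_mono) (simp_all add: spectral_norm_nonneg)
    finally show ?thesis by simp
  qed
  then show ?thesis
    by (intro exI[of _ 1] exI[of _ "48 * spectral_norm A"]) simp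
qed

end
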